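(* Let $n\ge 2$ and $d\ge 1$ be integers and let $\alpha$ be a real number with $0\le \frac{\alpha}{2}\le 1$. Suppose that an $n$-order tensor $\mathcal{S}\in\mathbb{R}^{d\times\cdots\times d}$ is generated according to the Bernoulli distribution with expectation $\frac{\alpha}{2}$, i.e., the entries $\mathcal{S}_{i_1,\cdots,i_n}$ ($1\le i_1,\dots,i_n\le d$) are independent random variables with $\mathcal{S}_{i_1,\cdots,i_n}\sim\mathtt{Ber}(\frac{\alpha}{2})$, and suppose that $$\alpha d>\frac{2n\log d}{\log 4-1}.$$ Then $\mathcal{S}$ is $\alpha$-T-sparse with probability at least $$1-nd^{\,1-nd^{n-2}}.$$ Moreover, for any integer $k\in[1,n-1]$, if $\mathcal{S}$ is unfolded along some particular choice of $k$ modes into a matrix $M\in\mathbb{R}^{d^{k}\times d^{n-k}}$, then $M$ is $\alpha$-M-sparse with probability at least $$1-d^{\,k-nd^{n-k-1}}-d^{\,n-k-nd^{k-1}}.$$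
   Context: All logarithms are natural logarithms. $\mathtt{Ber}(p)$ denotes the Bernoulli distribution on $\{0,1\}$ with expectation $p$. $\|\cdot\|_0$ denotes the number of non-zero entries of a vector, matrix or tensor. $\alpha$-M-sparsity (for matrices): a matrix $S\in\mathbb{R}^{d_1\times d_2}$ is $\alpha$-M-sparse if $\|S\boldsymbol{e}_i\|_0\le \alpha d_1$ and $\|\boldsymbol{e}_j^\top S\|_0\le \alpha d_2$ for all $i=1,\cdots,d_2$ and $j=1,\cdots,d_1$, where $\boldsymbol{e}_i$ and $\boldsymbol{e}_j$ are standard basis vectors of $\mathbb{R}^{d_2}$ and $\mathbb{R}^{d_1}$ respectively; that is, every column has at most $\alpha d_1$ non-zero entries and every row has at most $\alpha d_2$ non-zero entries. Mode-$j$ product: for $\mathcal{X}\in\mathbb{R}^{d_1\times\cdots\times d_n}$ and a matrix $A\in\mathbb{R}^{J\times d_j}$, the tensor $\mathcal{X}\times_j A$ has entries $(\mathcal{X}\times_j A)_{i_1,\cdots,i_{j-1},l,i_{j+1},\cdots,i_n}=\sum_{s=1}^{d_j}\mathcal{X}_{i_1,\cdots,i_{j-1},s,i_{j+1},\cdots,i_n}A_{l,s}$. $\alpha$-T-sparsity (for tensors): a tensor $\mathcal{S}\in\mathbb{R}^{d_1\times\cdots\times d_n}$ is $\alpha$-T-sparse if for every mode $j=1,\cdots,n$ and every $k_j=1,\cdots,d_j$, $$\|\mathcal{S}\times_j \boldsymbol{e}_{k_j,j}^\top\|_0\le \alpha\prod_{i\ne j}d_i,$$ where $\{\boldsymbol{e}_{k_j,j}\}_{k_j=1}^{d_j}$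 is the standard basis of $\mathbb{R}^{d_j}$. Here $\mathcal{S}\times_j \boldsymbol{e}_{k_j,j}^\top$ is the $k_j$-th slice of $\mathcal{S}$ along mode $j$ (the entries of $\mathcal{S}$ whose $j$-th index equals $k_j$). Unfolding into a $d^k\times d^{n-k}$ matrix: given a set of $k$ of the $n$ modes of $\mathcal{S}\in\mathbb{R}^{d\times\cdots\times d}$, the unfolded matrix $M\in\mathbb{R}^{d^k\times d^{n-k}}$ is the rearrangement of the entries of $\mathcal{S}$ in which rows are indexed by the tuples of indices in the chosen $k$ modes and columns are indexed by the tuples of indices in the remaining $n-k$ modes. *)

theory Defs
  imports "HOL-Probability.Probability"
begin

text \<open>
  A tensor of order \<open>n\<close> with dimensions \<open>d 1, \<dots>, d n\<close> is a function on multi-indices, of which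
  only the values on \<open>tensor_index {1..n} d\<close> matter; a multi-index is an extensional function
  from the set of modes to the positive naturals.
\<close>

type_synonym tensor = "(nat \<Rightarrow> nat) \<Rightarrow> real"

definition tensor_index :: "nat set \<Rightarrow> (nat \<Rightarrow> nat) \<Rightarrow> (nat \<Rightarrow> nat) set" where
  "tensor_index J d = (\<Pi>\<^sub>E j\<in>J. {1..d j})"

definition tensor_nnz :: "nat \<Rightarrow> (nat \<Rightarrow> nat) \<Rightarrow> tensor \<Rightarrow> nat" where
  "tensor_nnz n d X = card {i \<in> tensor_index {1..n} d. X i \<noteq> 0}"

definition std_basis :: "'a \<Rightarrow> 'a \<Rightarrow> real" where
  "std_basis k = (\<lambda>s. if s = k then 1 else 0)"

text \<open>
  Mode-\<open>j\<close> product of a tensor of dimensions \<open>d\<close> with a matrix \<open>A\<close> having \<open>J\<close> rows and \<open>d j\<close>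
  columns; the result has dimensions \<open>d(j := J)\<close>.
\<close>

definition mode_product :: "(nat \<Rightarrow> nat) \<Rightarrow> nat \<Rightarrow> tensor \<Rightarrow> (nat \<Rightarrow> nat \<Rightarrow> real) \<Rightarrow> tensor" where
  "mode_product d j X A = (\<lambda>i. \<Sum>s = 1..d j. X (i(j := s)) * A (i j) s)"

text \<open>
  The transposed basis vector is a matrix with a single row, hence the slice has
  dimension 1 in mode \<open>j\<close>.
\<close>

definition T_sparse :: "nat \<Rightarrow> (nat \<Rightarrow> nat) \<Rightarrow> real \<Rightarrow> tensor \<Rightarrow> bool" where
  "T_sparse n d \<alpha> S \<longleftrightarrow>
     (\<forall>j\<in>{1..n}. \<forall>k\<in>{1..d j}.
        real (tensor_nnz n (d(j := 1)) (mode_product d j S (\<lambda>_. std_basis k)))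
          \<le> \<alpha> * (\<Prod>i\<in>{1..n} - {j}. real (d i)))"

text \<open>
  Matrices have rows and columns indexed by arbitrary finite sets \<open>R\<close> and \<open>C\<close>, so that
  \<open>d\<^sub>1 = card R\<close> and \<open>d\<^sub>2 = card C\<close>. The first conjunct concerns the columns
  \<open>S e\<^sub>i\<close>, the second one the rows \<open>e\<^sub>j\<^sup>T S\<close>.
\<close>

definition M_sparse :: "'r set \<Rightarrow> 'c set \<Rightarrow> real \<Rightarrow> ('r \<Rightarrow> 'c \<Rightarrow> real) \<Rightarrow> bool" where
  "M_sparse R C \<alpha> S \<longleftrightarrow>
     (\<forall>i\<in>C. real (card {r\<in>R. (\<Sum>c\<in>C. S r c * std_basis i c) \<noteq> 0}) \<le> \<alpha> * real (card R)) \<and>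
     (\<forall>j\<in>R. real (card {c\<in>C. (\<Sum>r\<in>R. std_basis j r * S r c) \<noteq> 0}) \<le> \<alpha> * real (card C))"

text \<open>
  Unfolding along the modes in \<open>K\<close>: rows are indexed by \<open>tensor_index K d\<close>, columns by
  \<open>tensor_index ({1..n} - K) d\<close>.
\<close>

definition unfold_tensor :: "nat \<Rightarrow> nat set \<Rightarrow> tensor \<Rightarrow> (nat \<Rightarrow> nat) \<Rightarrow> (nat \<Rightarrow> nat) \<Rightarrow> real" where
  "unfold_tensor n K S = (\<lambda>r c. S (merge K ({1..n} - K) (r, c)))"

lemma card_tensor_index_const:
  "finite K \<Longrightarrow> card (tensor_index K (\<lambda>_. d)) = d ^ card K"
  by (simp add: tensor_index_def card_PiE)

text \<open>The Bernoulli distribution on \<open>{0, 1}\<close>, as a Borel measure on the reals.\<close>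

definition Ber :: "real \<Rightarrow> real measure" where
  "Ber p = distr (measure_pmf (bernoulli_pmf p)) borel of_bool"

end

theory Submission
  imports Defs
begin

text \<open>
  Both kinds of sparsity say that certain blocks of entries of the tensor (slices of the tensor,
  rows and columns of the unfolding) contain at most \<open>\<alpha> N\<close> non-zero entries, where \<open>N\<close> is the size
  of the block. The number \<open>X\<close> of non-zero entries of such a block is binomial with mean
  \<open>(\<alpha> / 2) N\<close>, so the question is how likely \<open>X\<close> is to exceed twice its mean. The exponential
  moment method with base 2 answers this: since \<open>E (2 ^ X) = (1 + \<alpha> / 2) ^ N \<le> exp ((\<alpha> / 2) N)\<close>,
  Markov's inequality at level \<open>2 powr (\<alpha> N) = exp (ln 4 * (\<alpha> / 2) * N)\<close> gives
  \<open>Pr (X > \<alpha> N) \<le> exp (- (ln 4 - 1) * (\<alpha> / 2) * N)\<close> (lemma \<open>count_nonzero_tail\<close>). This is where the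
  constant \<open>ln 4 - 1\<close> comes from.

  Every block has \<open>N = d ^ Suc m\<close> entries for some \<open>m\<close>: \<open>m = n - 2\<close> for a slice, \<open>m = k - 1\<close> for a
  column and \<open>m = n - k - 1\<close> for a row of the unfolding. The assumed lower bound on \<open>\<alpha> d\<close> then turns
  the tail into \<open>d powr (- n * d ^ m)\<close>. Summing these over the \<open>n * d\<close> slices,
  or over the \<open>d ^ (n - k)\<close> columns and the \<open>d ^ k\<close> rows, gives the claimed probabilities
  (lemma \<open>prob_all_blocks_sparse\<close>). Different blocks share entries, so their counts
  are dependent, and a union bound is the natural way to combine them.
\<close>

section \<open>Counting non-zero Bernoulli variables\<close>

lemma ln4_gt_1: "ln 4 > (1::real)"
proof -
  have "exp 1 < (4::real)"
    using exp_le by linarith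
  then show ?thesis
    by (metis exp_less_cancel_iff exp_ln zero_less_numeral)
qed

lemma integral_Ber:
  fixes f :: "real \<Rightarrow> real"
  assumes "0 \<le> p" "p \<le> 1" and [measurable]: "f \<in> borel_measurable borel"
  shows "integrable (Ber p) f" and "(\<integral>x. f x \<partial>Ber p) = f 1 * p + f 0 * (1 - p)"
proof -
  show "integrable (Ber p) f"
    unfolding Ber_def
    by (subst integrable_distr_eq) (auto intro: integrable_measure_pmf_finite)
  have "(\<integral>x. f x \<partial>Ber p) = (\<integral>b. f (of_bool b) \<partial>measure_pmf (bernoulli_pmf p))"
    unfolding Ber_def by (subst integral_distr) auto
  then show "(\<integral>x. f x \<partial>Ber p) = f 1 * p + f 0 * (1 - p)"
    using assms by simp
qed

context prob_space
begin

lemma count_nonzero_measurable: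
  fixes X :: "'i \<Rightarrow> 'a \<Rightarrow> real"
  assumes "finite J" and [measurable]: "\<And>i. i \<in> J \<Longrightarrow> random_variable borel (X i)"
  shows "(\<lambda>\<omega>. real (card {i\<in>J. X i \<omega> \<noteq> 0})) \<in> borel_measurable M"
proof -
  have "real (card {i\<in>J. X i \<omega> \<noteq> 0}) = (\<Sum>i\<in>J. if X i \<omega> \<noteq> 0 then 1 else 0)" for \<omega>
    using assms(1) by (simp add: sum.If_cases Int_def)
  then show ?thesis
    by simp
qed

text \<open>
  Giving a non-zero entry the weight \<open>b > 1\<close> would lead to the bound
  \<open>exp ((b - 1 - 2 * ln b) * p * card J)\<close>, whose exponent is smallest at \<open>b = 2\<close>.
\<close>

lemma count_nonzero_tail:
  fixes X :: "'i \<Rightarrow> 'a \<Rightarrow> real"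
  assumes J: "finite J" and ind: "indep_vars (\<lambda>_. borel) X J"
    and Ber: "\<And>i. i \<in> J \<Longrightarrow> distr M borel (X i) = Ber p"
    and p: "0 \<le> p" "p \<le> 1"
  shows "prob {\<omega>\<in>space M. real (card {i\<in>J. X i \<omega> \<noteq> 0}) > 2 * p * real (card J)}
           \<le> exp (- (ln 4 - 1) * p * real (card J))"
proof -
  define f :: "real \<Rightarrow> real" where "f x = (if x = 0 then 1 else 2)" for x
  let ?N = "real (card J)"
  let ?C = "\<lambda>\<omega>. card {i\<in>J. X i \<omega> \<noteq> 0}"
  have f_meas [measurable]: "f \<in> borel_measurable borel"
    unfolding f_def by measurable
  have rv [measurable]: "random_variable borel (X i)" if "i \<in> J" for i
    using ind that by (auto simp: indep_vars_def)
  have ind_f: "indep_vars (\<lambda>_. borel) (\<lambda>i \<omega>. f (X i \<omega>)) J"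
    by (rule indep_vars_compose2[OF ind]) simp
  have int1: "integrable M (\<lambda>\<omega>. f (X i \<omega>))" if "i \<in> J" for i
    using that integral_Ber(1)[OF p f_meas] by (simp add: Ber[symmetric] integrable_distr_eq)
  have exp1: "expectation (\<lambda>\<omega>. f (X i \<omega>)) = 1 + p" if "i \<in> J" for i
  proof -
    have "expectation (\<lambda>\<omega>. f (X i \<omega>)) = (\<integral>x. f x \<partial>Ber p)"
      using that by (simp add: Ber[symmetric] integral_distr)
    also have "\<dots> = 1 + p"
      using integral_Ber(2)[OF p f_meas] by (simp add: f_def)
    finally show ?thesis .
  qed
  have prod: "(\<Prod>i\<in>J. f (X i \<omega>)) = 2 ^ ?C \<omega>" for \<omega>
  proof -
    have "(\<Prod>i\<in>J. f (X i \<omega>)) = (\<Prod>i\<in>J. if X i \<omega> \<noteq> 0 then 2 else 1)"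
      by (rule prod.cong) (auto simp: f_def)
    then show ?thesis
      using J by (simp add: prod.If_cases Int_def)
  qed
  have int: "integrable M (\<lambda>\<omega>. 2 ^ ?C \<omega> :: real)"
    using indep_vars_integrable[OF J ind_f int1] by (simp add: prod)
  have "expectation (\<lambda>\<omega>. 2 ^ ?C \<omega>) = (\<Prod>i\<in>J. 1 + p)"
    using indep_vars_lebesgue_integral[OF J ind_f int1] exp1 by (simp add: prod)
  also have "\<dots> = (1 + p) ^ card J"
    by simp
  also have "\<dots> \<le> exp p ^ card J"
    using p by (intro power_mono) auto
  also have "\<dots> = exp (p * ?N)"
    by (simp add: exp_of_nat_mult[symmetric] mult.commute)
  finally have moment: "expectation (\<lambda>\<omega>. 2 ^ ?C \<omega>) \<le> exp (p * ?N)" .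
  let ?c = "exp (ln 4 * p * ?N)"
  have level: "?c \<le> 2 ^ ?C \<omega>" if "real (?C \<omega>) > 2 * p * ?N" for \<omega>
  proof -
    have ln4: "ln (4::real) = 2 * ln 2"
      using ln_realpow[of 2 2] by simp
    have "ln 4 * p * ?N = ln 2 * (2 * p * ?N)"
      by (simp add: ln4)
    also have "\<dots> \<le> ln 2 * real (?C \<omega>)"
      using that by (intro mult_left_mono) auto
    finally have "?c \<le> exp (real (?C \<omega>) * ln 2)"
      by (simp add: mult.commute)
    then show ?thesis
      by (simp add: exp_of_nat_mult)
  qed
  have "prob {\<omega>\<in>space M. real (?C \<omega>) > 2 * p * ?N}
      \<le> prob {\<omega>\<in>space M. ?c \<le> 2 ^ ?C \<omega>}"
  proof (rule finite_measure_mono)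
    show "{\<omega>\<in>space M. ?c \<le> 2 ^ ?C \<omega>} \<in> events"
      using borel_measurable_integrable[OF int] by measurable
  qed (use level in auto)
  also have "\<dots> \<le> expectation (\<lambda>\<omega>. 2 ^ ?C \<omega>) / ?c"
    by (rule integral_Markov_inequality_measure[OF int, where A = "{}"]) auto
  also have "\<dots> \<le> exp (p * ?N) / ?c"
    using moment by (intro divide_right_mono) auto
  also have "\<dots> = exp (- (ln 4 - 1) * p * ?N)"
    by (simp add: exp_diff[symmetric] algebra_simps)
  finally show ?thesis .
qed

section \<open>Simultaneous sparsity of a family of blocks\<close>

text \<open>
  Each block \<open>J t\<close> has \<open>d ^ Suc (m t)\<close> entries. One factor \<open>d\<close> of this size is combined with \<open>\<alpha>\<close> in
  order to use the lower bound on \<open>\<alpha> d\<close>, which leaves \<open>d ^ m t\<close> in the exponent.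
\<close>

lemma prob_all_blocks_sparse:
  fixes X :: "'i \<Rightarrow> 'a \<Rightarrow> real" and J :: "'t \<Rightarrow> 'i set"
  assumes T: "finite T" and J: "\<And>t. t \<in> T \<Longrightarrow> finite (J t) \<and> J t \<subseteq> I"
    and card_J: "\<And>t. t \<in> T \<Longrightarrow> card (J t) = d ^ Suc (m t)"
    and ind: "indep_vars (\<lambda>_. borel) X I"
    and Ber: "\<And>i. i \<in> I \<Longrightarrow> distr M borel (X i) = Ber (\<alpha> / 2)"
    and \<alpha>: "0 \<le> \<alpha> / 2" "\<alpha> / 2 \<le> 1" and d: "d \<ge> 1"
    and large: "\<alpha> * real d > 2 * real n * ln (real d) / (ln 4 - 1)"
  shows "prob {\<omega>\<in>space M. \<forall>t\<in>T. real (card {i\<in>J t. X i \<omega> \<noteq> 0}) \<le> \<alpha> * real (card (J t))}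
           \<ge> 1 - (\<Sum>t\<in>T. real d powr (- (real n * real d ^ m t)))"
    (is "prob ?good \<ge> _")
proof -
  define bad where
    "bad t = {\<omega>\<in>space M. real (card {i\<in>J t. X i \<omega> \<noteq> 0}) > \<alpha> * real (card (J t))}" for t
  have rv: "random_variable borel (X i)" if "i \<in> I" for i
    using ind that by (auto simp: indep_vars_def)
  have bad_event: "bad t \<in> events" if "t \<in> T" for t
  proof -
    have [measurable]: "(\<lambda>\<omega>. real (card {i\<in>J t. X i \<omega> \<noteq> 0})) \<in> borel_measurable M"
      using J[OF that] by (intro count_nonzero_measurable rv) auto
    show ?thesis
      unfolding bad_def by measurable
  qed
  have bad_le: "prob (bad t) \<le> real d powr (- (real n * real d ^ m t))" if t: "t \<in> T" for t
  proof -
    have "prob (bad t) \<le> exp (- (ln 4 - 1) * (\<alpha> / 2) * real (card (J t)))"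
      using count_nonzero_tail[of "J t" X "\<alpha> / 2"] J[OF t] indep_vars_subset[OF ind] Ber \<alpha>
      by (auto simp: bad_def)
    also have "\<dots> \<le> exp (- (real n * real d ^ m t) * ln (real d))"
    proof -
      have "2 * real n * ln (real d) \<le> (ln 4 - 1) * (\<alpha> * real d)"
        using large ln4_gt_1 by (simp add: field_simps)
      then have "2 * real n * ln (real d) * real d ^ m t \<le> (ln 4 - 1) * (\<alpha> * real d) * real d ^ m t"
        by (intro mult_right_mono) auto
      then show ?thesis
        by (simp add: card_J[OF t] algebra_simps)
    qed
    also have "\<dots> = real d powr (- (real n * real d ^ m t))"
      using d by (simp add: powr_def)
    finally show ?thesis .
  qed
  have "prob (\<Union>t\<in>T. bad t) \<le> (\<Sum>t\<in>T. prob (bad t))"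
    using bad_event by (intro finite_measure_subadditive_finite T) auto
  also have "\<dots> \<le> (\<Sum>t\<in>T. real d powr (- (real n * real d ^ m t)))"
    by (intro sum_mono bad_le)
  finally have "prob (\<Union>t\<in>T. bad t) \<le> (\<Sum>t\<in>T. real d powr (- (real n * real d ^ m t)))" .
  moreover have "prob (space M - (\<Union>t\<in>T. bad t)) = 1 - prob (\<Union>t\<in>T. bad t)"
    using bad_event T by (intro prob_compl sets.finite_UN) auto
  moreover have "?good = space M - (\<Union>t\<in>T. bad t)"
    by (auto simp: bad_def not_less)
  ultimately show ?thesis
    by simp
qed

end

section \<open>Slices, rows and columns as blocks of entries\<close>

lemma finite_tensor_index: "finite J \<Longrightarrow> finite (tensor_index J d)"
  by (simp add: tensor_index_def finite_PiE)

lemma sum_std_basis: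
  "finite A \<Longrightarrow> k \<in> A \<Longrightarrow> (\<Sum>s\<in>A. f s * std_basis k s) = f k"
  by (simp add: std_basis_def if_distrib[where f = "\<lambda>x. _ * x"] cong: if_cong)

lemma slice_eq_PiE:
  assumes "j \<in> J" "k \<in> {1..d j}"
  shows "{i \<in> tensor_index J d. i j = k} = (\<Pi>\<^sub>E l\<in>J. if l = j then {k} else {1..d l})"
    (is "?L = ?R")
proof (rule set_eqI)
  fix i
  show "i \<in> ?L \<longleftrightarrow> i \<in> ?R"
    using assms by (auto simp: tensor_index_def PiE_iff split: if_splits)
qed

lemma card_slice:
  assumes "finite J" "j \<in> J" "k \<in> {1..d j}"
  shows "card {i \<in> tensor_index J d. i j = k} = (\<Prod>l\<in>J - {j}. d l)"
proof -
  have "card {i \<in> tensor_index J d. i j = k} = (\<Prod>l\<in>J. if l = j then 1 else d l)"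
    using assms by (simp add: slice_eq_PiE card_PiE if_distrib[where f = card] cong: if_cong)
  also have "\<dots> = (\<Prod>l\<in>J - {j}. d l)"
    using assms by (subst prod.remove[of J j]) auto
  finally show ?thesis .
qed

text \<open>
  The slice along mode \<open>j\<close> is itself a tensor, whose index in mode \<open>j\<close> is always 1. Replacing that 1
  by \<open>k\<close> identifies its index set with the indices of the original tensor that have \<open>j\<close>-th
  component \<open>k\<close>.
\<close>

lemma tensor_nnz_slice:
  assumes j: "j \<in> {1..n}" and k: "k \<in> {1..d j}"
  shows "tensor_nnz n (d(j := 1)) (mode_product d j X (\<lambda>_. std_basis k))
           = card {i \<in> {i \<in> tensor_index {1..n} d. i j = k}. X i \<noteq> 0}"
proof -
  have val: "mode_product d j X (\<lambda>_. std_basis k) i = X (i(j := k))" for i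
    using k by (simp add: mode_product_def sum_std_basis)
  have upd_in: "i(j := l) \<in> tensor_index {1..n} d'"
    if "i \<in> tensor_index {1..n} d''" "l \<in> {1..d' j}" "\<And>t. t \<noteq> j \<Longrightarrow> d' t = d'' t"
    for i l and d' d'' :: "nat \<Rightarrow> nat"
    using that j by (auto simp: tensor_index_def PiE_iff extensional_def)
  have at_j: "i j = 1" if "i \<in> tensor_index {1..n} (d(j := 1))" for i
    using that j by (force simp: tensor_index_def PiE_iff)
  have "bij_betw (\<lambda>i. i(j := k))
          {i \<in> tensor_index {1..n} (d(j := 1)). X (i(j := k)) \<noteq> 0}
          {i \<in> {i \<in> tensor_index {1..n} d. i j = k}. X i \<noteq> 0}"
  proof (rule bij_betwI[where g = "\<lambda>i. i(j := 1)"])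
    show "(\<lambda>i. i(j := k)) \<in> {i \<in> tensor_index {1..n} (d(j := 1)). X (i(j := k)) \<noteq> 0} \<rightarrow>
            {i \<in> {i \<in> tensor_index {1..n} d. i j = k}. X i \<noteq> 0}"
      using k by (auto intro!: upd_in[where d'' = "d(j := 1)"] simp del: One_nat_def)
    show "(\<lambda>i. i(j := 1)) \<in> {i \<in> {i \<in> tensor_index {1..n} d. i j = k}. X i \<noteq> 0} \<rightarrow>
            {i \<in> tensor_index {1..n} (d(j := 1)). X (i(j := k)) \<noteq> 0}"
      by (auto intro!: upd_in[where d'' = d] simp: fun_upd_idem simp del: One_nat_def)
  qed (auto simp: fun_upd_idem dest: at_j simp del: One_nat_def)
  then show ?thesis
    unfolding tensor_nnz_def val by (rule bij_betw_same_card)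
qed

lemma T_sparse_iff_slices:
  "T_sparse n d \<alpha> X \<longleftrightarrow>
     (\<forall>(j, k) \<in> (SIGMA j:{1..n}. {1..d j}).
        real (card {i \<in> {i \<in> tensor_index {1..n} d. i j = k}. X i \<noteq> 0})
          \<le> \<alpha> * real (card {i \<in> tensor_index {1..n} d. i j = k}))"
proof -
  have "real (card {i \<in> tensor_index {1..n} d. i j = k}) = (\<Prod>i\<in>{1..n} - {j}. real (d i))"
    if "j \<in> {1..n}" "k \<in> {1..d j}" for j k
    using card_slice[of "{1..n}" j k d] that by simp
  then show ?thesis
    unfolding T_sparse_def Ball_def by (auto simp: tensor_nnz_slice simp del: mem_Collect_eq One_nat_def)
qed

text \<open>
  Sparsity of the unfolding concerns positions in a matrix, whereas independence and the tail bound
  concern entries of the tensor. The two index sets below pull a column or row of the unfolding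
  along the modes \<open>K\<close> back to the tensor.
\<close>

definition unfold_column :: "nat \<Rightarrow> (nat \<Rightarrow> nat) \<Rightarrow> nat set \<Rightarrow> (nat \<Rightarrow> nat) \<Rightarrow> (nat \<Rightarrow> nat) set" where
  "unfold_column n d K c = (\<lambda>r. merge K ({1..n} - K) (r, c)) ` tensor_index K d"

definition unfold_row :: "nat \<Rightarrow> (nat \<Rightarrow> nat) \<Rightarrow> nat set \<Rightarrow> (nat \<Rightarrow> nat) \<Rightarrow> (nat \<Rightarrow> nat) set" where
  "unfold_row n d K r = (\<lambda>c. merge K ({1..n} - K) (r, c)) ` tensor_index ({1..n} - K) d"

lemma merge_tensor_index:
  assumes "K \<subseteq> {1..n}" "r \<in> tensor_index K d" "c \<in> tensor_index ({1..n} - K) d"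
  shows "merge K ({1..n} - K) (r, c) \<in> tensor_index {1..n} d"
proof -
  have "K \<union> ({1..n} - K) = {1..n}"
    using assms(1) by auto
  then show ?thesis
    using assms PiE_cancel_merge[of K "{1..n} - K" r c "\<lambda>j. {1..d j}"]
    by (simp add: tensor_index_def PiE_def)
qed

lemma inj_on_merge_left: "K \<inter> L = {} \<Longrightarrow> inj_on (\<lambda>r. merge K L (r, c)) (tensor_index K d)"
  by (rule inj_on_inverseI[where g = "\<lambda>i. restrict i K"])
     (simp add: tensor_index_def PiE_restrict)

lemma inj_on_merge_right: "K \<inter> L = {} \<Longrightarrow> inj_on (\<lambda>c. merge K L (r, c)) (tensor_index L d)"
  by (rule inj_on_inverseI[where g = "\<lambda>i. restrict i L"])
     (simp add: tensor_index_def PiE_restrict)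

lemma card_image_filter:
  assumes "inj_on f A"
  shows "card {x \<in> f ` A. Q x} = card {a \<in> A. Q (f a)}"
proof -
  have "{x \<in> f ` A. Q x} = f ` {a \<in> A. Q (f a)}"
    by auto
  then show ?thesis
    using assms by (simp add: card_image inj_on_def)
qed

text \<open>
  Merging is injective in either argument, so counting non-zero entries in a column or row of the
  unfolding is the same as counting them over the corresponding set of tensor indices.
\<close>

lemma M_sparse_unfold_iff:
  assumes "K \<subseteq> {1..n}"
  shows "M_sparse (tensor_index K d) (tensor_index ({1..n} - K) d) \<alpha> (unfold_tensor n K X) \<longleftrightarrow>
     (\<forall>c \<in> tensor_index ({1..n} - K) d. real (card {i \<in> unfold_column n d K c. X i \<noteq> 0})
        \<le> \<alpha> * real (card (unfold_column n d K c))) \<and>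
     (\<forall>r \<in> tensor_index K d. real (card {i \<in> unfold_row n d K r. X i \<noteq> 0})
        \<le> \<alpha> * real (card (unfold_row n d K r)))"
proof -
  have "finite (tensor_index K d)" "finite (tensor_index ({1..n} - K) d)"
    using assms by (auto intro!: finite_tensor_index dest: finite_subset)
  then show ?thesis
    unfolding M_sparse_def unfold_tensor_def unfold_column_def unfold_row_def
    by (simp add: sum_std_basis mult.commute[of "std_basis _ _"] card_image_filter card_image
        inj_on_merge_left inj_on_merge_right)
qed

section \<open>Sparsity of Bernoulli tensors\<close>


theorem theorem2p3:
  fixes P :: "'w measure" and S :: "(nat \<Rightarrow> nat) \<Rightarrow> 'w \<Rightarrow> real"
    and n d :: nat and \<alpha> :: real
  assumes "n \<ge> 2" and "d \<ge> 1"
    and "0 \<le> \<alpha> / 2" and "\<alpha> / 2 \<le> 1"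
    and "prob_space P"
    and "prob_space.indep_vars P (\<lambda>_. borel) S (tensor_index {1..n} (\<lambda>_. d))"
    and "\<And>i. i \<in> tensor_index {1..n} (\<lambda>_. d) \<Longrightarrow> distr P borel (S i) = Ber (\<alpha> / 2)"
    and "\<alpha> * real d > 2 * real n * ln (real d) / (ln 4 - 1)"
  shows "measure P {\<omega> \<in> space P. T_sparse n (\<lambda>_. d) \<alpha> (\<lambda>i. S i \<omega>)}
           \<ge> 1 - real n * real d powr (1 - real n * real d ^ (n - 2)) \<and>
         (\<forall>k\<in>{1..n - 1}. \<forall>K. K \<subseteq> {1..n} \<and> card K = k \<longrightarrow>
           measure P {\<omega> \<in> space P.
               M_sparse (tensor_index K (\<lambda>_. d)) (tensor_index ({1..n} - K) (\<lambda>_. d)) \<alpha>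
                 (unfold_tensor n K (\<lambda>i. S i \<omega>))}
             \<ge> 1 - real d powr (real k - real n * real d ^ (n - k - 1))
                 - real d powr (real (n - k) - real n * real d ^ (k - 1)))"
proof -
  interpret prob_space P
    by (rule assms(5))
  note blocks = prob_all_blocks_sparse[OF _ _ _ assms(6,7,3,4,2,8)]
  let ?d = "\<lambda>_::nat. d"
  let ?I = "tensor_index {1..n} ?d"
  have d: "real d > 0"
    using assms(2) by simp
  have "1 - real n * real d powr (1 - real n * real d ^ (n - 2))
          \<le> prob {\<omega> \<in> space P. T_sparse n ?d \<alpha> (\<lambda>i. S i \<omega>)}"
  proof -
    let ?T = "{1..n} \<times> {1..d}"
    let ?J = "\<lambda>(j, k). {i \<in> ?I. i j = k}"
    have card_J: "card (?J t) = d ^ Suc (n - 2)" if "t \<in> ?T" for t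
    proof -
      have "Suc (n - 2) = n - 1"
        using assms(1) by simp
      then show ?thesis
        using that by (auto simp: card_slice simp del: One_nat_def power_Suc)
    qed
    have eq: "T_sparse n ?d \<alpha> X \<longleftrightarrow>
        (\<forall>t\<in>?T. real (card {i \<in> ?J t. X i \<noteq> 0}) \<le> \<alpha> * real (card (?J t)))" for X
      by (simp add: T_sparse_iff_slices split_beta)
    have "1 - (\<Sum>t\<in>?T. real d powr (- (real n * real d ^ (n - 2))))
            \<le> prob {\<omega> \<in> space P. T_sparse n ?d \<alpha> (\<lambda>i. S i \<omega>)}"
      unfolding eq by (rule blocks) (use card_J in \<open>auto simp: finite_tensor_index\<close>)
    then show ?thesis
      using d by (simp add: powr_diff powr_minus_divide)
  qed
  moreover have "1 - real d powr (real k - real n * real d ^ (n - k - 1))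
        - real d powr (real (n - k) - real n * real d ^ (k - 1))
      \<le> prob {\<omega> \<in> space P. M_sparse (tensor_index K ?d) (tensor_index ({1..n} - K) ?d) \<alpha>
               (unfold_tensor n K (\<lambda>i. S i \<omega>))}"
    if k: "k \<in> {1..n - 1}" and K: "K \<subseteq> {1..n}" "card K = k" for k K
  proof -
    let ?R = "tensor_index K ?d" and ?C = "tensor_index ({1..n} - K) ?d"
    \<comment> \<open>Columns and rows are treated as one family, so that a single union bound covers both.\<close>
    let ?J = "case_sum (unfold_column n ?d K) (unfold_row n ?d K)"
    let ?m = "case_sum (\<lambda>_. k - 1) (\<lambda>_. n - k - 1)"
    have finK: "finite K"
      using K finite_subset by blast
    have fin: "finite ?R" "finite ?C"
      using finK by (simp_all add: finite_tensor_index)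
    have card_K': "card ({1..n} - K) = n - k"
      using K finK by (simp add: card_Diff_subset)
    have card_R: "card ?R = d ^ k" and card_C: "card ?C = d ^ (n - k)"
      using K finK card_K' by (simp_all add: card_tensor_index_const)
    have card_J: "card (?J t) = d ^ Suc (?m t)" if "t \<in> ?C <+> ?R" for t
    proof (cases t)
      case (Inl c)
      then show ?thesis
        using k card_R
        by (simp add: unfold_column_def card_image inj_on_merge_left flip: power_Suc)
    next
      case (Inr r)
      have "Suc (n - k - 1) = n - k"
        using k by auto
      then show ?thesis
        using Inr card_C
        by (simp add: unfold_row_def card_image inj_on_merge_right flip: power_Suc)
    qed
    have eq: "M_sparse ?R ?C \<alpha> (unfold_tensor n K X) \<longleftrightarrow>
        (\<forall>t \<in> ?C <+> ?R. real (card {i \<in> ?J t. X i \<noteq> 0}) \<le> \<alpha> * real (card (?J t)))" for X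
      unfolding M_sparse_unfold_iff[OF K(1)] by (auto simp: Plus_def ball_Un)
    have "1 - (\<Sum>t \<in> ?C <+> ?R. real d powr (- (real n * real d ^ ?m t)))
            \<le> prob {\<omega> \<in> space P. M_sparse ?R ?C \<alpha> (unfold_tensor n K (\<lambda>i. S i \<omega>))}"
      unfolding eq
    proof (rule blocks)
      show "finite (?J t) \<and> ?J t \<subseteq> ?I" if "t \<in> ?C <+> ?R" for t
        using that fin K(1) by (auto simp: unfold_column_def unfold_row_def merge_tensor_index
            simp del: One_nat_def)
    qed (use card_J fin in auto)
    moreover have "(\<Sum>t \<in> ?C <+> ?R. real d powr (- (real n * real d ^ ?m t)))
        = real d powr (real (n - k) - real n * real d ^ (k - 1))
          + real d powr (real k - real n * real d ^ (n - k - 1))"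
      using d fin
      by (simp add: sum.Plus card_R card_C powr_diff powr_minus_divide powr_realpow
          del: One_nat_def)
    ultimately show ?thesis
      by simp
  qed
  ultimately show ?thesis
    by blast
qed

end
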